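(* Let $L:\Sigma\to\mathbb{S}^5$ be a contact stationary Legendrian surface in the unit sphere $\mathbb{S}^5$ with its canonical Sasakian structure. If $L$ is totally umbilical, then $L$ is totally geodesic.
   Context: $\mathbb{S}^5\subset\mathbb{C}^3$ is the unit sphere with its round metric $g_\alpha$ of constant sectional curvature $1$ and its canonical Sasakian structure. The contact form $\alpha$ is the restriction of $\sum_{j=1}^3(x_j\,dy_j-y_j\,dx_j)$, where $z_j=x_j+iy_j$. The Reeb field $\mathbf{R}$ is the unit vector field $\mathbf{R}_z=iz$. $J$ denotes the complex structure on the contact distribution $\ker\alpha$, given by multiplication by $i$. A Legendrian surface is an immersion $L:\Sigma\to\mathbb{S}^5$ of a 2-dimensional manifold with $L^*\alpha=0$; it carries the induced metric $g$. For a local orthonormal tangent frame $\{e_1,e_2\}$, the normal bundle of $L$ in $\mathbb{S}^5$ is spanned by $Je_1,Je_2,\mathbf{R}$. Let $B$ be the second fundamental form of $L$ in $\mathbb{S}^5$, let $S=|B|^2=\sum_{i,j}|B(e_i,e_j)|^2$, and let $\vec H=\frac12\sum_i B(e_i,e_i)$ be the mean curvature vector, with $H^2=|\vec H|^2$. Since $L$ is Legendrian, $B$ has no $\mathbf{R}$-component, so $\vec H$ is a section of $J(TL)$ and $J\vec H$ is tangent to $L$. $L$ is contact stationary if it is a critical point of the area functional with respect to (compactly supported) variations through Legendrian surfaces; equivalently, $L$ satisfies the Euler–Lagrange equation $\mathrm{div}_g(J\vec H)=0$. $L$ is totally umbilical if $\rho^2:=S-2H^2$ vanishes identically (equivalently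 $B(X,Y)=g(X,Y)\vec H$ for all tangent $X,Y$), and totally geodesic if $B\equiv0$ (equivalently $S\equiv 0$). *)

theory Defs
  imports "HOL-Analysis.Analysis"
begin

(* Only used for open S.  Derivatives of order k + 1 are expressed through all directional
   derivatives, which in finite dimensions gives the usual C^k condition. *)
primrec Ck_on :: "nat \<Rightarrow> 'a::real_normed_vector set \<Rightarrow> ('a \<Rightarrow> 'b::real_normed_vector) \<Rightarrow> bool" where
  "Ck_on 0 = (\<lambda>S f. continuous_on S f)"
| "Ck_on (Suc k) = (\<lambda>S f.
     (\<forall>x\<in>S. f differentiable (at x)) \<and> (\<forall>v. Ck_on k S (\<lambda>x. frechet_derivative f (at x) v)))"

definition smooth_on :: "'a::real_normed_vector set \<Rightarrow> ('a \<Rightarrow> 'b::real_normed_vector) \<Rightarrow> bool" where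
  "smooth_on S f \<longleftrightarrow> (\<forall>k. Ck_on k S f)"


(* A chart is a pair of its domain and its coordinate map.  A surface is given by a smooth atlas,
   not necessarily maximal; its underlying set is the union of the chart domains, an open subset
   of the ambient topological type. *)
type_synonym 'a chart = "'a set \<times> ('a \<Rightarrow> real^2)"

definition chart_image :: "'a chart \<Rightarrow> (real^2) set" where
  "chart_image c = snd c ` fst c"

definition chart_inv :: "'a chart \<Rightarrow> real^2 \<Rightarrow> 'a" where
  "chart_inv c = inv_into (fst c) (snd c)"

definition carrier_of :: "'a chart set \<Rightarrow> 'a set" where
  "carrier_of \<A> = (\<Union>c\<in>\<A>. fst c)"

definition smooth_surface ::
    "'a::{t2_space, second_countable_topology} chart set \<Rightarrow> bool" where
  "smooth_surface \<A> \<longleftrightarrow>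
     (\<forall>c\<in>\<A>. open (fst c) \<and> open (chart_image c) \<and>
        homeomorphism (fst c) (chart_image c) (snd c) (chart_inv c)) \<and>
     (\<forall>c\<in>\<A>. \<forall>d\<in>\<A>. smooth_on (snd c ` (fst c \<inter> fst d)) (snd d \<circ> chart_inv c))"


(* The inner product of complex^3 is the real one, Re (sum_j v_j * cnj w_j), so that
   sphere 0 1 is the unit 5-sphere with its round metric. *)
definition contact_form :: "complex^3 \<Rightarrow> complex^3 \<Rightarrow> real" where
  "contact_form z v = (\<Sum>j\<in>UNIV. Re (z $ j) * Im (v $ j) - Im (z $ j) * Re (v $ j))"

definition legendrian_immersion ::
    "'a::{t2_space, second_countable_topology} chart set \<Rightarrow> ('a \<Rightarrow> complex^3) \<Rightarrow> bool" where
  "legendrian_immersion \<A> L \<longleftrightarrow>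
     L ` carrier_of \<A> \<subseteq> sphere 0 1 \<and>
     (\<forall>c\<in>\<A>. smooth_on (chart_image c) (L \<circ> chart_inv c) \<and>
        (\<forall>x\<in>chart_image c.
           inj (frechet_derivative (L \<circ> chart_inv c) (at x)) \<and>
           (\<forall>v. contact_form ((L \<circ> chart_inv c) x)
                  (frechet_derivative (L \<circ> chart_inv c) (at x) v) = 0)))"


(* Below, F is a local parametrization of an immersed surface in the unit sphere, i.e. the
   immersion read in a chart; tangent vectors at x are represented by their coordinate vectors. *)

definition induced_metric :: "(real^2 \<Rightarrow> complex^3) \<Rightarrow> real^2 \<Rightarrow> real^2 \<Rightarrow> real^2 \<Rightarrow> real" where
  "induced_metric F x u v = frechet_derivative F (at x) u \<bullet> frechet_derivative F (at x) v"

definition normal_space :: "(real^2 \<Rightarrow> complex^3) \<Rightarrow> real^2 \<Rightarrow> (complex^3) set" where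
  "normal_space F x = {n. n \<bullet> F x = 0 \<and> (\<forall>u. n \<bullet> frechet_derivative F (at x) u = 0)}"

definition orth_proj :: "'a::euclidean_space set \<Rightarrow> 'a \<Rightarrow> 'a" where
  "orth_proj V w = (THE n. n \<in> V \<and> (\<forall>m\<in>V. (w - n) \<bullet> m = 0))"

lemma orth_proj_eqI:
  assumes "subspace V" "n \<in> V" "\<And>m. m \<in> V \<Longrightarrow> (w - n) \<bullet> m = 0"
  shows "orth_proj V w = n"
  unfolding orth_proj_def
proof (rule the_equality)
  fix n' assume n': "n' \<in> V \<and> (\<forall>m\<in>V. (w - n') \<bullet> m = 0)"
  then have "n' - n \<in> V" using assms subspace_diff by blast
  then have "(w - n) \<bullet> (n' - n) = 0" "(w - n') \<bullet> (n' - n) = 0"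
    using assms n' by auto
  then have "(n' - n) \<bullet> (n' - n) = 0" by (simp add: inner_diff_left)
  then show "n' = n" by simp
qed (use assms in auto)

lemma orth_proj_props:
  assumes "subspace V"
  shows "orth_proj V w \<in> V" and "m \<in> V \<Longrightarrow> (w - orth_proj V w) \<bullet> m = 0"
proof -
  obtain y z where yz: "y \<in> span V" "\<And>m. m \<in> span V \<Longrightarrow> orthogonal z m" "w = y + z"
    using orthogonal_subspace_decomp_exists[of V w] by metis
  have sp: "span V = V" using assms by (simp add: span_eq_iff)
  have "orth_proj V w = y"
    by (rule orth_proj_eqI[OF assms]) (use yz sp in \<open>auto simp: orthogonal_def\<close>)
  with yz sp show "orth_proj V w \<in> V" and "m \<in> V \<Longrightarrow> (w - orth_proj V w) \<bullet> m = 0"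
    by (auto simp: orthogonal_def)
qed

lemma subspace_normal_space: "subspace (normal_space F x)"
  by (auto simp: subspace_def normal_space_def inner_add_left)

(* The Levi-Civita connection of the round sphere is the tangential part of the flat derivative.
   Since normal_space is contained in the tangent space of the sphere, the normal part of the
   sphere derivative is the projection of the flat second derivative D_u (D_v F), where u and v
   are extended to constant coordinate fields. *)
definition second_ff ::
    "(real^2 \<Rightarrow> complex^3) \<Rightarrow> real^2 \<Rightarrow> real^2 \<Rightarrow> real^2 \<Rightarrow> complex^3" where
  "second_ff F x u v = orth_proj (normal_space F x)
     (frechet_derivative (\<lambda>y. frechet_derivative F (at y) v) (at x) u)"

definition orthonormal_frame :: "(real^2 \<Rightarrow> complex^3) \<Rightarrow> real^2 \<Rightarrow> (2 \<Rightarrow> real^2) \<Rightarrow> bool" where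
  "orthonormal_frame F x e \<longleftrightarrow>
     (\<forall>i j. induced_metric F x (e i) (e j) = (if i = j then 1 else 0))"

(* The value is the same for every orthonormal frame e at x; likewise for mean_curvature. *)
definition second_ff_norm_sq :: "(real^2 \<Rightarrow> complex^3) \<Rightarrow> real^2 \<Rightarrow> (2 \<Rightarrow> real^2) \<Rightarrow> real" where
  "second_ff_norm_sq F x e = (\<Sum>i\<in>UNIV. \<Sum>j\<in>UNIV. (norm (second_ff F x (e i) (e j)))\<^sup>2)"

definition mean_curvature :: "(real^2 \<Rightarrow> complex^3) \<Rightarrow> real^2 \<Rightarrow> (2 \<Rightarrow> real^2) \<Rightarrow> complex^3" where
  "mean_curvature F x e = (1/2) *\<^sub>R (\<Sum>i\<in>UNIV. second_ff F x (e i) (e i))"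

definition totally_umbilical ::
    "'a chart set \<Rightarrow> ('a \<Rightarrow> complex^3) \<Rightarrow> bool" where
  "totally_umbilical \<A> L \<longleftrightarrow>
     (\<forall>c\<in>\<A>. \<forall>x\<in>chart_image c. \<forall>e. orthonormal_frame (L \<circ> chart_inv c) x e \<longrightarrow>
        second_ff_norm_sq (L \<circ> chart_inv c) x e
          - 2 * (norm (mean_curvature (L \<circ> chart_inv c) x e))\<^sup>2 = 0)"

definition totally_geodesic ::
    "'a chart set \<Rightarrow> ('a \<Rightarrow> complex^3) \<Rightarrow> bool" where
  "totally_geodesic \<A> L \<longleftrightarrow>
     (\<forall>c\<in>\<A>. \<forall>x\<in>chart_image c. \<forall>u v. second_ff (L \<circ> chart_inv c) x u v = 0)"


definition area_density :: "(real^2 \<Rightarrow> complex^3) \<Rightarrow> real^2 \<Rightarrow> real" where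
  "area_density F x = sqrt (det (\<chi> i j. induced_metric F x (axis i 1) (axis j 1)))"

(* Area of K in the induced metric: the supremum of the total area of finitely many disjoint Borel
   pieces of K, each lying in a chart domain and measured in that chart.  This agrees with the
   Riemannian area measure; for compact K finitely many pieces exhaust K. *)
definition area ::
    "'a::{t2_space, second_countable_topology} chart set \<Rightarrow> ('a \<Rightarrow> complex^3) \<Rightarrow> 'a set \<Rightarrow> real" where
  "area \<A> L K = enn2real
     (SUP P \<in> {P. finite P \<and> disjoint_family_on snd P \<and>
                 (\<forall>(c, B)\<in>P. c \<in> \<A> \<and> B \<in> sets borel \<and> B \<subseteq> fst c \<inter> K)}.
        \<Sum>(c, B)\<in>P. \<integral>\<^sup>+x\<in>snd c ` B. ennreal (area_density (L \<circ> chart_inv c) x) \<partial>lborel)"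

definition legendrian_variation ::
    "'a::{t2_space, second_countable_topology} chart set \<Rightarrow> ('a \<Rightarrow> complex^3) \<Rightarrow>
     real \<Rightarrow> 'a set \<Rightarrow> (real \<Rightarrow> 'a \<Rightarrow> complex^3) \<Rightarrow> bool" where
  "legendrian_variation \<A> L \<epsilon> K \<Phi> \<longleftrightarrow>
     \<epsilon> > 0 \<and> compact K \<and> K \<subseteq> carrier_of \<A> \<and>
     (\<forall>c\<in>\<A>. smooth_on ({-\<epsilon><..<\<epsilon>} \<times> chart_image c) (\<lambda>(t, x). \<Phi> t (chart_inv c x))) \<and>
     (\<forall>t\<in>{-\<epsilon><..<\<epsilon>}. legendrian_immersion \<A> (\<Phi> t)) \<and>
     (\<forall>p\<in>carrier_of \<A>. \<Phi> 0 p = L p) \<and>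
     (\<forall>t\<in>{-\<epsilon><..<\<epsilon>}. \<forall>p\<in>carrier_of \<A> - K. \<Phi> t p = L p)"

definition contact_stationary ::
    "'a::{t2_space, second_countable_topology} chart set \<Rightarrow> ('a \<Rightarrow> complex^3) \<Rightarrow> bool" where
  "contact_stationary \<A> L \<longleftrightarrow>
     (\<forall>\<epsilon> K \<Phi>. legendrian_variation \<A> L \<epsilon> K \<Phi> \<longrightarrow>
        ((\<lambda>t. area \<A> (\<Phi> t) K) has_real_derivative 0) (at 0))"

end

theory Submission
  imports Defs
begin

text \<open>
  The cubic form \<open>(u, v, w) \<mapsto> B(u, v) \<bullet> J w\<close> of a Legendrian immersion is totally symmetric:
  differentiating \<open>J F \<bullet> D\<^sub>v F = 0\<close> yields \<open>J D\<^sub>u F \<bullet> D\<^sub>v F = 0\<close> and \<open>J F \<bullet> D\<^sub>u D\<^sub>v F = 0\<close>, and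
  differentiating once more exchanges \<open>v\<close> and \<open>w\<close>.  Umbilicity says \<open>B(e\<^sub>i, e\<^sub>j) = \<delta>\<^sub>i\<^sub>j H\<close>, so
  \<open>H \<bullet> J e\<^sub>1 = B(e\<^sub>2, e\<^sub>2) \<bullet> J e\<^sub>1 = B(e\<^sub>2, e\<^sub>1) \<bullet> J e\<^sub>2 = 0\<close> and likewise \<open>H \<bullet> J e\<^sub>2 = 0\<close>.  As \<open>H\<close> is also
  orthogonal to the Reeb direction \<open>J F\<close>, it vanishes, and hence so does \<open>B\<close>.
\<close>

section \<open>Calculus on open sets and the symmetry of second derivatives\<close>

lemma has_derivative_const_on_open:
  assumes "open S" "x \<in> S" "\<And>y. y \<in> S \<Longrightarrow> g y = c" "(g has_derivative g') (at x)"
  shows "g' v = 0"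
proof -
  have "((\<lambda>y. c) has_derivative g') (at x)"
    using has_derivative_transform_within_open[OF assms(4,1,2)] assms(3) by simp
  then have "g' = (\<lambda>v. 0)"
    using has_derivative_unique has_derivative_const by blast
  then show ?thesis by simp
qed

text \<open>Chain rule along a line; it makes the one-variable mean value theorem applicable to
  directional derivatives.\<close>

lemma has_real_derivative_along_line:
  fixes f :: "'a::real_normed_vector \<Rightarrow> real"
  assumes "f differentiable (at (p + s *\<^sub>R w))"
  shows "((\<lambda>s. f (p + s *\<^sub>R w)) has_real_derivative
           frechet_derivative f (at (p + s *\<^sub>R w)) w) (at s)"
proof -
  let ?D = "frechet_derivative f (at (p + s *\<^sub>R w))"
  have D: "(f has_derivative ?D) (at (p + s *\<^sub>R w))"
    using assms frechet_derivative_works by blast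
  have "((\<lambda>s. p + s *\<^sub>R w) has_derivative (\<lambda>r. r *\<^sub>R w)) (at s)"
    by (auto intro!: derivative_eq_intros)
  then have "((\<lambda>s. f (p + s *\<^sub>R w)) has_derivative (\<lambda>r. ?D (r *\<^sub>R w))) (at s)"
    using D by (rule has_derivative_compose)
  moreover have "(\<lambda>r. ?D (r *\<^sub>R w)) = (*) (?D w)"
    using linear_scale[OF has_derivative_linear[OF D]] by (simp add: fun_eq_iff mult.commute)
  ultimately show ?thesis
    by (simp only: has_field_derivative_def)
qed

text \<open>The mean value theorem is applied twice: first in the direction \<open>u\<close> to the
  increment of \<open>f\<close> over \<open>h *\<^sub>R v\<close>, then in the direction
  \<open>v\<close> to the resulting increment of the \<open>u\<close>-derivative.\<close>

lemma second_difference_mvt: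
  fixes f :: "'a::real_normed_vector \<Rightarrow> real"
  assumes h: "h > 0"
    and sub: "\<And>s t. \<lbrakk>0 \<le> s; s \<le> h; 0 \<le> t; t \<le> h\<rbrakk> \<Longrightarrow> x + s *\<^sub>R u + t *\<^sub>R v \<in> S"
    and f: "\<And>y. y \<in> S \<Longrightarrow> f differentiable (at y)"
    and fu: "\<And>y. y \<in> S \<Longrightarrow> (\<lambda>z. frechet_derivative f (at z) u) differentiable (at y)"
  obtains s t where "0 < s" "s < h" "0 < t" "t < h"
    "f (x + h *\<^sub>R u + h *\<^sub>R v) - f (x + h *\<^sub>R u) - f (x + h *\<^sub>R v) + f x
      = h\<^sup>2 * frechet_derivative (\<lambda>z. frechet_derivative f (at z) u)
                (at (x + s *\<^sub>R u + t *\<^sub>R v)) v"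
proof -
  let ?fu = "\<lambda>z. frechet_derivative f (at z) u"
  define g where "g s = f ((x + h *\<^sub>R v) + s *\<^sub>R u) - f (x + s *\<^sub>R u)" for s
  have g: "(g has_real_derivative (?fu ((x + h *\<^sub>R v) + s *\<^sub>R u) - ?fu (x + s *\<^sub>R u))) (at s)"
    if "0 \<le> s" "s \<le> h" for s
  proof -
    have "(x + h *\<^sub>R v) + s *\<^sub>R u \<in> S" "x + s *\<^sub>R u \<in> S"
      using sub[of s h] sub[of s 0] that h by (simp_all add: add_ac)
    then show ?thesis
      unfolding g_def
      using DERIV_diff[OF has_real_derivative_along_line[of f "x + h *\<^sub>R v" s u]
          has_real_derivative_along_line[of f x s u]] f by blast
  qed
  obtain s where s: "0 < s" "s < h"
    "g h - g 0 = (h - 0) * (?fu ((x + h *\<^sub>R v) + s *\<^sub>R u) - ?fu (x + s *\<^sub>R u))"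
    using MVT2[OF h g] by blast
  have k: "((\<lambda>t. ?fu ((x + s *\<^sub>R u) + t *\<^sub>R v)) has_real_derivative
             frechet_derivative ?fu (at ((x + s *\<^sub>R u) + t *\<^sub>R v)) v) (at t)"
    if "0 \<le> t" "t \<le> h" for t
    using sub[of s t] that s fu
    by (intro has_real_derivative_along_line[of ?fu "x + s *\<^sub>R u" t v]) auto
  obtain t where t: "0 < t" "t < h"
    "?fu ((x + s *\<^sub>R u) + h *\<^sub>R v) - ?fu ((x + s *\<^sub>R u) + 0 *\<^sub>R v)
       = (h - 0) * frechet_derivative ?fu (at ((x + s *\<^sub>R u) + t *\<^sub>R v)) v"
    using MVT2[OF h k] by blast
  have "f (x + h *\<^sub>R u + h *\<^sub>R v) - f (x + h *\<^sub>R u) - f (x + h *\<^sub>R v) + f x = g h - g 0"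
    by (simp add: g_def algebra_simps)
  also have "\<dots> = h * (?fu ((x + s *\<^sub>R u) + h *\<^sub>R v) - ?fu ((x + s *\<^sub>R u) + 0 *\<^sub>R v))"
    using s(3) by (simp add: add_ac)
  also have "\<dots> = h\<^sup>2 * frechet_derivative ?fu (at (x + s *\<^sub>R u + t *\<^sub>R v)) v"
    unfolding t(3) by (simp add: power2_eq_square)
  finally show ?thesis
    using that s(1,2) t(1,2) by blast
qed

text \<open>The second difference over a parallelogram is symmetric in its two edges. So the two
  mixed derivatives agree at suitable points of arbitrarily small parallelograms, and continuity
  carries this over to \<open>x\<close>.\<close>

lemma mixed_derivatives_commute_real:
  fixes f :: "'a::real_normed_vector \<Rightarrow> real"
  assumes S: "open S" "x \<in> S"
    and f: "\<And>y. y \<in> S \<Longrightarrow> f differentiable (at y)"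
    and df: "\<And>y w. y \<in> S \<Longrightarrow> (\<lambda>z. frechet_derivative f (at z) w) differentiable (at y)"
    and cont: "\<And>w w'. continuous_on S
      (\<lambda>y. frechet_derivative (\<lambda>z. frechet_derivative f (at z) w) (at y) w')"
  shows "frechet_derivative (\<lambda>z. frechet_derivative f (at z) u) (at x) v
       = frechet_derivative (\<lambda>z. frechet_derivative f (at z) v) (at x) u"
proof -
  let ?D = "\<lambda>w w' y. frechet_derivative (\<lambda>z. frechet_derivative f (at z) w) (at y) w'"
  \<comment> \<open>The summand 0 gives the bound the shape that \<open>field_le_epsilon\<close>
    expects.\<close>
  have "\<bar>?D u v x - ?D v u x\<bar> \<le> 0 + e" if e: "e > 0" for e :: real
  proof -
    have "\<exists>d>0. \<forall>y. dist y x < d \<longrightarrow> y \<in> S \<and> dist (?D w w' y) (?D w w' x) < e / 2" for w w'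
    proof -
      have "isCont (?D w w') x"
        using cont S by (simp add: continuous_on_eq_continuous_at)
      then obtain d1 where d1: "d1 > 0" "\<forall>y. dist y x < d1 \<longrightarrow> dist (?D w w' y) (?D w w' x) < e/2"
        using e unfolding continuous_at_eps_delta by (metis half_gt_zero)
      obtain d2 where d2: "d2 > 0" "\<forall>y. dist y x < d2 \<longrightarrow> y \<in> S"
        using S open_dist by blast
      from d1 d2 show ?thesis
        by (intro exI[of _ "min d1 d2"]) auto
    qed
    then obtain d1 d2 where
      d1: "d1 > 0" "\<And>y. dist y x < d1 \<Longrightarrow> y \<in> S \<and> dist (?D u v y) (?D u v x) < e / 2" and
      d2: "d2 > 0" "\<And>y. dist y x < d2 \<Longrightarrow> y \<in> S \<and> dist (?D v u y) (?D v u x) < e / 2"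
      by meson
    \<comment> \<open>For \<open>s\<close>, \<open>t\<close> in [0, h] the displacement has norm at
      most \<open>h * M\<close>, which is half of \<open>min d1 d2\<close>. The added 1 keeps
      \<open>M\<close> positive when \<open>u\<close> and \<open>v\<close> both vanish.\<close>
    define M where "M = norm u + norm v + 1"
    define h where "h = min d1 d2 / (2 * M)"
    have M: "M > 0" unfolding M_def by (intro add_nonneg_pos) auto
    have h: "h > 0" using M d1 d2 by (simp add: h_def)
    have near: "dist (x + s *\<^sub>R u + t *\<^sub>R v) x < min d1 d2"
      if "0 \<le> s" "s \<le> h" "0 \<le> t" "t \<le> h" for s t
    proof -
      have "dist (x + s *\<^sub>R u + t *\<^sub>R v) x = norm (s *\<^sub>R u + t *\<^sub>R v)"
        by (simp add: dist_norm)
      also have "\<dots> \<le> s * norm u + t * norm v"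
        using norm_triangle_ineq[of "s *\<^sub>R u" "t *\<^sub>R v"] that by simp
      also have "\<dots> \<le> h * norm u + h * norm v"
        using that by (intro add_mono mult_right_mono) auto
      also have "\<dots> \<le> h * M"
        using h by (simp add: M_def algebra_simps)
      also have "\<dots> < min d1 d2"
        using M d1(1) d2(1) by (simp add: h_def) (auto simp: min_def)
      finally show ?thesis .
    qed
    have in_S: "x + s *\<^sub>R u + t *\<^sub>R v \<in> S" "x + s *\<^sub>R v + t *\<^sub>R u \<in> S"
      if "0 \<le> s" "s \<le> h" "0 \<le> t" "t \<le> h" for s t
      using d1(2) near[OF that] near[OF that(3,4,1,2)] by (auto simp: add_ac)
    obtain s t where st: "0 < s" "s < h" "0 < t" "t < h"
      "f (x + h *\<^sub>R u + h *\<^sub>R v) - f (x + h *\<^sub>R u) - f (x + h *\<^sub>R v) + f x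
        = h\<^sup>2 * ?D u v (x + s *\<^sub>R u + t *\<^sub>R v)"
      by (rule second_difference_mvt[OF h in_S(1) f df])
    obtain s' t' where st': "0 < s'" "s' < h" "0 < t'" "t' < h"
      "f (x + h *\<^sub>R v + h *\<^sub>R u) - f (x + h *\<^sub>R v) - f (x + h *\<^sub>R u) + f x
        = h\<^sup>2 * ?D v u (x + s' *\<^sub>R v + t' *\<^sub>R u)"
      by (rule second_difference_mvt[OF h in_S(2) f df])
    \<comment> \<open>Both sides are the same second difference, with the edges taken in opposite
      order.\<close>
    have "h\<^sup>2 * ?D u v (x + s *\<^sub>R u + t *\<^sub>R v) = h\<^sup>2 * ?D v u (x + s' *\<^sub>R v + t' *\<^sub>R u)"
      unfolding st(5)[symmetric] st'(5)[symmetric] by (simp add: algebra_simps)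
    then have eq: "?D u v (x + s *\<^sub>R u + t *\<^sub>R v) = ?D v u (x + t' *\<^sub>R u + s' *\<^sub>R v)"
      using h by (simp add: add_ac)
    have "dist (?D u v (x + s *\<^sub>R u + t *\<^sub>R v)) (?D u v x) < e / 2"
      using d1(2) near[of s t] st by auto
    moreover have "dist (?D v u (x + t' *\<^sub>R u + s' *\<^sub>R v)) (?D v u x) < e / 2"
      using d2(2) near[of t' s'] st' by auto
    ultimately show ?thesis
      unfolding eq dist_real_def by linarith
  qed
  then have "\<bar>?D u v x - ?D v u x\<bar> \<le> 0"
    by (rule field_le_epsilon)
  then show ?thesis by simp
qed

lemma frechet_derivative_inner_right:
  assumes "f differentiable (at y)"
  shows "(\<lambda>z. f z \<bullet> b) differentiable (at y)"
    and "frechet_derivative (\<lambda>z. f z \<bullet> b) (at y) = (\<lambda>v. frechet_derivative f (at y) v \<bullet> b)"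
proof -
  have "((\<lambda>z. f z \<bullet> b) has_derivative (\<lambda>v. frechet_derivative f (at y) v \<bullet> b)) (at y)"
    using assms frechet_derivative_works has_derivative_inner_left by blast
  then show "(\<lambda>z. f z \<bullet> b) differentiable (at y)"
    and "frechet_derivative (\<lambda>z. f z \<bullet> b) (at y) = (\<lambda>v. frechet_derivative f (at y) v \<bullet> b)"
    by (auto simp: differentiable_def intro: frechet_derivative_at[symmetric])
qed

text \<open>Formulas for first derivatives are available on \<open>S\<close> only; since
  \<open>S\<close> is open, they may be differentiated again at its points.\<close>

lemma frechet_derivative_cong_on_open:
  assumes "open S" "x \<in> S" "\<And>y. y \<in> S \<Longrightarrow> f y = g y" "f differentiable (at x)"
  shows "g differentiable (at x)" and "frechet_derivative g (at x) = frechet_derivative f (at x)"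
proof -
  have "(f has_derivative frechet_derivative f (at x)) (at x)"
    using assms(4) frechet_derivative_works by blast
  then have "(g has_derivative frechet_derivative f (at x)) (at x)"
    using assms(1-3) by (rule has_derivative_transform_within_open)
  then show "g differentiable (at x)" "frechet_derivative g (at x) = frechet_derivative f (at x)"
    by (auto simp: differentiable_def intro: frechet_derivative_at[symmetric])
qed

text \<open>Pairing with a fixed vector \<open>b\<close> commutes with both differentiations and
  reduces the claim to real-valued functions.\<close>

lemma mixed_derivatives_commute:
  fixes f :: "'a::real_normed_vector \<Rightarrow> 'b::real_inner"
  assumes S: "open S" "x \<in> S" and C2: "Ck_on 2 S f"
  shows "frechet_derivative (\<lambda>z. frechet_derivative f (at z) u) (at x) v
       = frechet_derivative (\<lambda>z. frechet_derivative f (at z) v) (at x) u"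
proof -
  have f: "\<And>y. y \<in> S \<Longrightarrow> f differentiable (at y)"
    and df: "\<And>y w. y \<in> S \<Longrightarrow> (\<lambda>z. frechet_derivative f (at z) w) differentiable (at y)"
    and cont: "\<And>w w'. continuous_on S
      (\<lambda>y. frechet_derivative (\<lambda>z. frechet_derivative f (at z) w) (at y) w')"
    using C2 by (auto simp: numeral_2_eq_2)
  let ?D = "\<lambda>w w' y. frechet_derivative (\<lambda>z. frechet_derivative f (at z) w) (at y) w'"
  have "?D u v x \<bullet> b = ?D v u x \<bullet> b" for b
  proof -
    let ?g = "\<lambda>z. f z \<bullet> b"
    have g: "?g differentiable (at y)"
        "frechet_derivative ?g (at y) w = frechet_derivative f (at y) w \<bullet> b" if "y \<in> S" for y w
      using frechet_derivative_inner_right[OF f[OF that]] by (auto simp: fun_eq_iff)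
    have dg: "(\<lambda>z. frechet_derivative ?g (at z) w) differentiable (at y)"
        "frechet_derivative (\<lambda>z. frechet_derivative ?g (at z) w) (at y) w' = ?D w w' y \<bullet> b"
      if "y \<in> S" for y w w'
      using frechet_derivative_cong_on_open[OF S(1) that, of "\<lambda>z. frechet_derivative f (at z) w \<bullet> b"]
        g(2) frechet_derivative_inner_right[OF df[OF that], of w b]
      by (auto simp: fun_eq_iff)
    have "continuous_on S (\<lambda>y. frechet_derivative (\<lambda>z. frechet_derivative ?g (at z) w) (at y) w')"
      for w w'
      using continuous_on_inner[OF cont[of w w'] continuous_on_const[of S b]]
      by (simp add: dg(2) cong: continuous_on_cong)
    then have "frechet_derivative (\<lambda>z. frechet_derivative ?g (at z) u) (at x) v
        = frechet_derivative (\<lambda>z. frechet_derivative ?g (at z) v) (at x) u"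
      by (intro mixed_derivatives_commute_real[OF S]) (use g dg in auto)
    then show ?thesis
      using dg(2)[OF S(2)] by simp
  qed
  then show ?thesis
    using vector_eq_rdot by blast
qed

section \<open>The complex structure and the contact form\<close>

definition J_mult :: "complex^'n \<Rightarrow> complex^'n" where
  "J_mult v = (\<chi> j. \<i> * v $ j)"

lemma linear_J_mult: "linear J_mult"
  by (rule linearI) (auto simp: J_mult_def vec_eq_iff algebra_simps)

lemma bounded_linear_J_mult: "bounded_linear J_mult"
  using linear_J_mult linear_conv_bounded_linear by blast

lemma inner_J_mult_J_mult [simp]: "J_mult v \<bullet> J_mult w = v \<bullet> w"
  by (auto simp: J_mult_def inner_vec_def inner_complex_def intro!: sum.cong)

lemma inner_J_mult_left: "J_mult v \<bullet> w = - (v \<bullet> J_mult w)"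
  by (auto simp: J_mult_def inner_vec_def inner_complex_def sum_negf[symmetric] intro!: sum.cong)

lemma inner_J_mult_self [simp]: "J_mult v \<bullet> v = 0" "v \<bullet> J_mult v = 0"
  using inner_J_mult_left[of v v] by (simp_all add: inner_commute)

text \<open>The contact form is the pairing with the Reeb field, so the Legendrian condition becomes
  an inner product identity that can be differentiated.\<close>

lemma contact_form_eq: "contact_form z v = J_mult z \<bullet> v"
  by (auto simp: J_mult_def contact_form_def inner_vec_def inner_complex_def intro!: sum.cong)

section \<open>Orthogonal frames\<close>

lemma length_orthogonal_list_le_DIM:
  fixes xs :: "'a::euclidean_space list"
  assumes "sorted_wrt orthogonal xs" "0 \<notin> set xs"
  shows "length xs \<le> DIM('a)"
proof -
  have "distinct xs \<and> pairwise orthogonal (set xs)"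
    using assms
    by (induction xs) (auto simp: pairwise_insert orthogonal_commute orthogonal_self)
  then have "distinct xs" "independent (set xs)"
    using assms(2) pairwise_orthogonal_independent by blast+
  then show ?thesis
    using independent_bound distinct_card by metis
qed

text \<open>A nonzero \<open>n\<close> would be a seventh member of an orthogonal family of nonzero
  vectors, but the real dimension of \<open>complex^3\<close> is 6. In the application
  \<open>p\<close> and \<open>q\<close> form a tangent frame and \<open>r\<close> is the position
  vector.\<close>

lemma eq_0_if_orthogonal_to_J_frame:
  fixes n p q r :: "complex^3"
  assumes unit: "p \<bullet> p = 1" "q \<bullet> q = 1" "r \<bullet> r = 1"
    and orth: "p \<bullet> q = 0" "p \<bullet> r = 0" "q \<bullet> r = 0"
      "J_mult p \<bullet> q = 0" "J_mult p \<bullet> r = 0" "J_mult q \<bullet> r = 0"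
    and n: "n \<bullet> p = 0" "n \<bullet> q = 0" "n \<bullet> r = 0"
      "n \<bullet> J_mult p = 0" "n \<bullet> J_mult q = 0" "n \<bullet> J_mult r = 0"
  shows "n = 0"
proof (rule ccontr)
  assume "n \<noteq> 0"
  let ?xs = "[n, p, q, r, J_mult p, J_mult q, J_mult r]"
  have "p \<bullet> J_mult q = 0" "p \<bullet> J_mult r = 0" "q \<bullet> J_mult r = 0"
    using orth by (metis inner_J_mult_left neg_equal_0_iff_equal)+
  then have "sorted_wrt orthogonal ?xs"
    using orth n by (simp add: orthogonal_def inner_commute)
  moreover have "J_mult p \<noteq> 0" "J_mult q \<noteq> 0" "J_mult r \<noteq> 0"
    using unit by (metis inner_J_mult_J_mult inner_zero_left zero_neq_one)+
  with unit \<open>n \<noteq> 0\<close> have "0 \<notin> set ?xs"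
    by auto
  ultimately have "length ?xs \<le> DIM(complex^3)"
    by (rule length_orthogonal_list_le_DIM)
  then show False
    by simp
qed

text \<open>An orthonormal basis of the two-dimensional range is pulled back along \<open>f\<close>;
  injectivity also pulls back the spanning property.\<close>

lemma orthonormal_image_frame:
  fixes f :: "real^2 \<Rightarrow> 'b::euclidean_space"
  assumes "linear f" "inj f"
  obtains e :: "2 \<Rightarrow> real^2" where
    "\<And>i j. f (e i) \<bullet> f (e j) = (if i = j then 1 else 0)"
    "\<And>u. \<exists>a b. u = a *\<^sub>R e 1 + b *\<^sub>R e 2"
proof -
  have "dim (range f) = 2"
    using dim_image_eq[OF assms(1), of UNIV] assms(2) by simp
  moreover have "subspace (range f)"
    using assms(1) linear_subspace_image subspace_UNIV by blast
  ultimately obtain B where B: "B \<subseteq> range f" "pairwise orthogonal B" "\<And>x. x \<in> B \<Longrightarrow> norm x = 1"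
      "card B = 2" "span B = range f"
    by (metis orthonormal_basis_subspace)
  then obtain p q where pq: "B = {p, q}" "p \<noteq> q"
    by (auto simp: card_2_iff)
  then obtain a b where ab: "p = f a" "q = f b"
    using B(1) by auto
  define e :: "2 \<Rightarrow> real^2" where "e = (\<lambda>i. if i = 1 then a else b)"
  have "f (e i) \<bullet> f (e j) = (if i = j then 1 else 0)" for i j
    using B(2) B(3)[of p] B(3)[of q] pq exhaust_2[of i] exhaust_2[of j]
    by (auto simp: e_def ab[symmetric] pairwise_insert orthogonal_def norm_eq_1 inner_commute)
  moreover have "\<exists>k l. u = k *\<^sub>R e 1 + l *\<^sub>R e 2" for u
  proof -
    have "f u \<in> span {p, q}"
      using B(5) pq by auto
    then obtain k l where "f u = k *\<^sub>R p + l *\<^sub>R q"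
      by (auto simp: span_breakdown_eq diff_eq_eq add.commute)
    then have "f u = f (k *\<^sub>R a + l *\<^sub>R b)"
      using assms(1) by (simp add: ab linear_add linear_scale)
    then show ?thesis
      using assms(2) by (auto simp: e_def dest: injD)
  qed
  ultimately show ?thesis
    using that by blast
qed

section \<open>Local geometry of a Legendrian immersion in one chart\<close>

locale legendrian_patch =
  fixes S :: "(real^2) set" and F :: "real^2 \<Rightarrow> complex^3"
  assumes open_S: "open S"
    and smooth: "smooth_on S F"
    and unit: "y \<in> S \<Longrightarrow> F y \<bullet> F y = 1"
    and immersion: "y \<in> S \<Longrightarrow> inj (frechet_derivative F (at y))"
    and legendrian: "y \<in> S \<Longrightarrow> J_mult (F y) \<bullet> frechet_derivative F (at y) v = 0"
begin

abbreviation D1 :: "real^2 \<Rightarrow> real^2 \<Rightarrow> complex^3" where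
  "D1 y v \<equiv> frechet_derivative F (at y) v"

text \<open>The derivative along \<open>v\<close> is taken first, then along \<open>u\<close>, as in
  \<open>second_ff\<close>.\<close>

abbreviation D2 :: "real^2 \<Rightarrow> real^2 \<Rightarrow> real^2 \<Rightarrow> complex^3" where
  "D2 y u v \<equiv> frechet_derivative (\<lambda>z. frechet_derivative F (at z) v) (at y) u"

lemma C2: "Ck_on 2 S F"
  using smooth by (auto simp: smooth_on_def)

lemma has_derivative_F: "y \<in> S \<Longrightarrow> (F has_derivative D1 y) (at y)"
  using C2 frechet_derivative_works by (auto simp: numeral_2_eq_2)

lemma has_derivative_D1: "y \<in> S \<Longrightarrow> ((\<lambda>z. D1 z v) has_derivative (\<lambda>u. D2 y u v)) (at y)"
  using C2 by (auto simp: numeral_2_eq_2 frechet_derivative_works[symmetric])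

lemma D2_commute: "y \<in> S \<Longrightarrow> D2 y u v = D2 y v u"
  using mixed_derivatives_commute[OF open_S _ C2] by blast

lemma linear_D1: "y \<in> S \<Longrightarrow> linear (D1 y)"
  using has_derivative_F has_derivative_linear by blast

lemma linear_D2_left: "y \<in> S \<Longrightarrow> linear (\<lambda>u. D2 y u v)"
  using has_derivative_D1 has_derivative_linear by blast

text \<open>Symmetry transfers linearity from the outer direction to the inner one.\<close>

lemma linear_D2_right: "y \<in> S \<Longrightarrow> linear (\<lambda>v. D2 y u v)"
  using linear_D2_left[of y u] D2_commute by simp

lemma F_orthogonal_D1:
  assumes "y \<in> S" shows "F y \<bullet> D1 y v = 0"
proof -
  have d: "((\<lambda>z. F z \<bullet> F z) has_derivative (\<lambda>v. F y \<bullet> D1 y v + D1 y v \<bullet> F y)) (at y)"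
    using has_derivative_inner has_derivative_F assms by blast
  have "F y \<bullet> D1 y v + D1 y v \<bullet> F y = 0"
    using has_derivative_const_on_open[OF open_S assms _ d, where v = v and c = 1] unit by blast
  then show ?thesis
    by (simp add: inner_commute)
qed

text \<open>This is the Legendrian condition for \<open>v\<close>, differentiated along
  \<open>u\<close>.\<close>

lemma J_F_D2_add_J_D1_D1:
  assumes "y \<in> S" shows "J_mult (F y) \<bullet> D2 y u v + J_mult (D1 y u) \<bullet> D1 y v = 0"
proof -
  have "((\<lambda>z. J_mult (F z)) has_derivative (\<lambda>u. J_mult (D1 y u))) (at y)"
    using bounded_linear.has_derivative[OF bounded_linear_J_mult has_derivative_F[OF assms]] .
  then have d: "((\<lambda>z. J_mult (F z) \<bullet> D1 z v) has_derivative
      (\<lambda>u. J_mult (F y) \<bullet> D2 y u v + J_mult (D1 y u) \<bullet> D1 y v)) (at y)"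
    using has_derivative_inner has_derivative_D1[OF assms] by blast
  show ?thesis
    using has_derivative_const_on_open[OF open_S assms _ d, where v = u and c = 0] legendrian
    by blast
qed

text \<open>In the preceding identity the first term is symmetric in \<open>u\<close> and
  \<open>v\<close>, whereas the second is antisymmetric because J is skew-adjoint. Hence the second
  vanishes: tangent planes are isotropic for the symplectic form of the ambient space.\<close>

lemma J_D1_orthogonal_D1:
  assumes "y \<in> S" shows "J_mult (D1 y u) \<bullet> D1 y v = 0"
  using J_F_D2_add_J_D1_D1[OF assms, of u v] J_F_D2_add_J_D1_D1[OF assms, of v u]
    D2_commute[OF assms, of u v] inner_J_mult_left[of "D1 y u" "D1 y v"]
  by (simp add: inner_commute)

text \<open>This is the reason why B has no Reeb component.\<close>

lemma J_F_orthogonal_D2: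
  assumes "y \<in> S" shows "J_mult (F y) \<bullet> D2 y u v = 0"
  using J_F_D2_add_J_D1_D1[OF assms] J_D1_orthogonal_D1[OF assms] by simp

text \<open>Differentiate the isotropy of the tangent planes along \<open>u\<close> and move J
  across by skew-adjointness.\<close>

lemma cubic_form_swap:
  assumes "y \<in> S" shows "D2 y u v \<bullet> J_mult (D1 y w) = D2 y u w \<bullet> J_mult (D1 y v)"
proof -
  have "((\<lambda>z. J_mult (D1 z v)) has_derivative (\<lambda>u. J_mult (D2 y u v))) (at y)"
    using bounded_linear.has_derivative[OF bounded_linear_J_mult has_derivative_D1[OF assms]] .
  then have d: "((\<lambda>z. J_mult (D1 z v) \<bullet> D1 z w) has_derivative
      (\<lambda>u. J_mult (D1 y v) \<bullet> D2 y u w + J_mult (D2 y u v) \<bullet> D1 y w)) (at y)"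
    using has_derivative_inner has_derivative_D1[OF assms] by blast
  have "J_mult (D1 y v) \<bullet> D2 y u w + J_mult (D2 y u v) \<bullet> D1 y w = 0"
    using has_derivative_const_on_open[OF open_S assms _ d, where v = u and c = 0]
      J_D1_orthogonal_D1 by blast
  then show ?thesis
    using inner_J_mult_left[of "D2 y u v" "D1 y w"] by (simp add: inner_commute)
qed

lemma J_D1_normal: "y \<in> S \<Longrightarrow> J_mult (D1 y u) \<in> normal_space F y"
  using legendrian[of y u] J_D1_orthogonal_D1[of y u] inner_J_mult_left[of "D1 y u" "F y"]
  by (auto simp: normal_space_def inner_commute)

lemma J_F_normal: "y \<in> S \<Longrightarrow> J_mult (F y) \<in> normal_space F y"
  using legendrian by (auto simp: normal_space_def)

lemma second_ff_normal: "second_ff F y u v \<in> normal_space F y"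
  unfolding second_ff_def by (rule orth_proj_props[OF subspace_normal_space])

text \<open>Against normal vectors the projection may be dropped, so identities for flat second
  derivatives pass to B.\<close>

lemma second_ff_inner_normal:
  "m \<in> normal_space F y \<Longrightarrow> second_ff F y u v \<bullet> m = D2 y u v \<bullet> m"
  using orth_proj_props(2)[OF subspace_normal_space, of m F y "D2 y u v"]
  by (simp add: second_ff_def inner_diff_left)

section \<open>Vanishing of B at an umbilic point\<close>

lemma second_ff_eq_0_if_umbilical:
  assumes x: "x \<in> S"
    and umb: "\<And>e. orthonormal_frame F x e \<Longrightarrow>
      second_ff_norm_sq F x e - 2 * (norm (mean_curvature F x e))\<^sup>2 = 0"
  shows "second_ff F x u v = 0"
proof -
  obtain e :: "2 \<Rightarrow> real^2" where e: "\<And>i j. D1 x (e i) \<bullet> D1 x (e j) = (if i = j then 1 else 0)"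
    and sp: "\<And>u. \<exists>a b. u = a *\<^sub>R e 1 + b *\<^sub>R e 2"
    using orthonormal_image_frame[OF linear_D1[OF x] immersion[OF x]] by blast
  let ?b = "\<lambda>i j. second_ff F x (e i) (e j)"
  have "orthonormal_frame F x e"
    using e by (simp add: orthonormal_frame_def induced_metric_def)
  \<comment> \<open>By the parallelogram law the umbilicity defect is a sum of squares, so each
    square vanishes.\<close>
  from umb[OF this] have "(norm (?b 1 1 - ?b 2 2))\<^sup>2 / 2 + (norm (?b 1 2))\<^sup>2 + (norm (?b 2 1))\<^sup>2 = 0"
    by (simp add: second_ff_norm_sq_def mean_curvature_def sum_2 power2_norm_eq_inner
        inner_add_left inner_add_right inner_diff_left inner_diff_right inner_commute field_simps)
  then have b: "?b 1 2 = 0" "?b 2 1 = 0" "?b 1 1 = ?b 2 2"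
    by (simp_all add: add_nonneg_eq_0_iff)
  have cubic: "?b i j \<bullet> J_mult (D1 x (e k)) = ?b i k \<bullet> J_mult (D1 x (e j))" for i j k
    using cubic_form_swap[OF x] by (simp add: second_ff_inner_normal J_D1_normal[OF x])
  have "?b 1 1 = 0"
  proof (rule eq_0_if_orthogonal_to_J_frame[of "D1 x (e 1)" "D1 x (e 2)" "F x"])
    \<comment> \<open>Replacing \<open>?b 1 1\<close> by \<open>?b 2 2\<close> makes the swap
      produce the off-diagonal entry \<open>?b 2 1\<close>.\<close>
    show "?b 1 1 \<bullet> J_mult (D1 x (e 1)) = 0"
      using cubic[of 2 2 1] b by simp
    show "?b 1 1 \<bullet> J_mult (D1 x (e 2)) = 0"
      using cubic[of 1 1 2] b by simp
    show "?b 1 1 \<bullet> J_mult (F x) = 0"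
      using second_ff_inner_normal[OF J_F_normal[OF x]] J_F_orthogonal_D2[OF x]
      by (simp add: inner_commute[of _ "J_mult (F x)"])
    show "?b 1 1 \<bullet> D1 x (e 1) = 0" "?b 1 1 \<bullet> D1 x (e 2) = 0" "?b 1 1 \<bullet> F x = 0"
      using second_ff_normal by (auto simp: normal_space_def)
    show "J_mult (D1 x (e 1)) \<bullet> F x = 0" "J_mult (D1 x (e 2)) \<bullet> F x = 0"
      using J_D1_normal[OF x] by (auto simp: normal_space_def)
    show "J_mult (D1 x (e 1)) \<bullet> D1 x (e 2) = 0"
      by (rule J_D1_orthogonal_D1[OF x])
  qed (use e unit[OF x] F_orthogonal_D1[OF x] in \<open>auto simp: inner_commute\<close>)
  then have b0: "?b i j = 0" for i j
    using b exhaust_2[of i] exhaust_2[of j] by auto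
  \<comment> \<open>To pass from the frame to arbitrary directions, bilinearity is used for the flat
    second derivative, tested against normal vectors, rather than for the projected form.\<close>
  have "D2 x u v \<bullet> m = 0" if m: "m \<in> normal_space F x" for m
  proof -
    have 0: "D2 x (e i) (e j) \<bullet> m = 0" for i j
      using second_ff_inner_normal[OF m, of "e i" "e j"] b0 by simp
    obtain a b c d where "u = a *\<^sub>R e 1 + b *\<^sub>R e 2" "v = c *\<^sub>R e 1 + d *\<^sub>R e 2"
      using sp by metis
    then show ?thesis
      by (simp only: linear_add[OF linear_D2_left[OF x]] linear_scale[OF linear_D2_left[OF x]]
          linear_add[OF linear_D2_right[OF x]] linear_scale[OF linear_D2_right[OF x]]
          inner_add_left inner_scaleR_left 0) simp
  qed
  then show ?thesis
    \<comment> \<open>A vector orthogonal to the whole normal space has projection 0.\<close>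
    unfolding second_ff_def
    by (intro orth_proj_eqI subspace_normal_space subspace_0) auto
qed

end

section \<open>From charts to the surface\<close>

theorem theorem1p2:
  fixes \<A> :: "'a::{t2_space, second_countable_topology} chart set"
    and L :: "'a \<Rightarrow> complex^3"
  assumes "smooth_surface \<A>"
    and "legendrian_immersion \<A> L"
    and "contact_stationary \<A> L"
    and "totally_umbilical \<A> L"
  shows "totally_geodesic \<A> L"
  unfolding totally_geodesic_def
proof (intro ballI allI)
  fix c x u v assume c: "c \<in> \<A>" and x: "x \<in> chart_image c"
  let ?F = "L \<circ> chart_inv c"
  have "legendrian_patch (chart_image c) ?F"
  proof
    show "open (chart_image c)"
      using assms(1) c by (simp add: smooth_surface_def)
    fix y assume y: "y \<in> chart_image c"
    \<comment> \<open>The sphere condition is stated on the carrier, so the chart point is first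
      carried back to the surface.\<close>
    then have "chart_inv c y \<in> carrier_of \<A>"
      using c by (auto simp: carrier_of_def chart_image_def chart_inv_def intro: inv_into_into)
    then have "?F y \<in> sphere 0 1"
      using assms(2) unfolding legendrian_immersion_def by auto
    then show "?F y \<bullet> ?F y = 1"
      by (simp add: norm_eq_1)
  qed (use assms(2) c in \<open>auto simp: legendrian_immersion_def contact_form_eq\<close>)
  then show "second_ff ?F x u v = 0"
    using legendrian_patch.second_ff_eq_0_if_umbilical x assms(4) c
    by (auto simp: totally_umbilical_def)
qed

end
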